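(* Let $Z$ be a topological space of class $\mathscr C$, let $z\in Z$, $x\in\mathfrak M$, and let $F:Z\to\mathfrak M$ be a continuous mapping with $F(z)=x$. Then $F(Z)\subset\pi(x)$, where $\pi(x)$ is the Gleason part of $x$.
   Context: $H^\infty$ is the Banach algebra of bounded holomorphic functions on the open unit disk $\mathbb D\subset\mathbb C$ with the supremum norm; $\mathfrak M$ is its maximal ideal space (the set of nonzero homomorphisms $H^\infty\to\mathbb C$ with the weak-$*$ topology), and $\hat f(\varphi)=\varphi(f)$ is the Gelfand transform. For $x,y\in\mathfrak M$ let $\rho(x,y)=\sup\{|\hat f(y)|: f\in H^\infty,\ \hat f(x)=0,\ \|f\|_{H^\infty}\le1\}$; the Gleason part of $x$ is $\pi(x)=\{y\in\mathfrak M:\rho(x,y)<1\}$. A topological space $Z$ is of class $\mathscr C$ if each pair of points of $Z$ belongs to the image of a continuous mapping from a connected first-countable $T_1$ space to $Z$. *)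

theory Defs
  imports "HOL-Complex_Analysis.Complex_Analysis"
begin

text \<open>
  Elements of \<open>H\<^sup>\<infinity>\<close> are functions on the open unit disk. As functions in HOL are total, the
  representing function is normalised to be 0 off the disk, so that equality in the type is
  equality on the disk.
\<close>

typedef hinf = "{f :: complex \<Rightarrow> complex.
    f holomorphic_on ball 0 1 \<and> bounded (f ` ball 0 1) \<and> (\<forall>z. z \<notin> ball 0 1 \<longrightarrow> f z = 0)}"
  morphisms hinf_apply Abs_hinf
  by (rule exI[of _ "\<lambda>_. 0"]) (auto simp: bounded_iff)

setup_lifting type_definition_hinf

lemma bounded_image_iff_norm: "bounded (f ` S) \<longleftrightarrow> (\<exists>B. \<forall>z\<in>S. norm (f z) \<le> B)"
  by (auto simp: bounded_iff)

lemma bounded_image_mult: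
  fixes f g :: "'a \<Rightarrow> complex"
  assumes "bounded (f ` S)" "bounded (g ` S)"
  shows "bounded ((\<lambda>z. f z * g z) ` S)"
proof -
  obtain B C where B: "\<And>z. z \<in> S \<Longrightarrow> norm (f z) \<le> B" and C: "\<And>z. z \<in> S \<Longrightarrow> norm (g z) \<le> C"
    using assms by (auto simp: bounded_image_iff_norm)
  have "norm (f z * g z) \<le> B * C" if "z \<in> S" for z
    unfolding norm_mult using B[OF that] C[OF that]
    by (intro mult_mono) (auto intro: order_trans[OF norm_ge_zero])
  then show ?thesis
    by (auto simp: bounded_image_iff_norm)
qed

instantiation hinf :: comm_ring_1
begin

lift_definition zero_hinf :: hinf is "\<lambda>_. 0"
  by (auto simp: bounded_iff)
lift_definition one_hinf :: hinf is "\<lambda>z. if z \<in> ball 0 1 then 1 else 0"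
  by (auto simp: bounded_iff intro: holomorphic_transform[of "\<lambda>_. 1"])
lift_definition plus_hinf :: "hinf \<Rightarrow> hinf \<Rightarrow> hinf" is "\<lambda>f g z. f z + g z"
  by (auto intro!: holomorphic_intros bounded_plus_comp)
lift_definition uminus_hinf :: "hinf \<Rightarrow> hinf" is "\<lambda>f z. - f z"
  by (auto intro!: holomorphic_intros simp: bounded_image_iff_norm)
lift_definition minus_hinf :: "hinf \<Rightarrow> hinf \<Rightarrow> hinf" is "\<lambda>f g z. f z - g z"
  by (auto intro!: holomorphic_intros bounded_minus_comp)
lift_definition times_hinf :: "hinf \<Rightarrow> hinf \<Rightarrow> hinf" is "\<lambda>f g z. f z * g z"
  by (auto intro!: holomorphic_intros bounded_image_mult)

instance
proof
  show "(0::hinf) \<noteq> 1"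
    by transfer (auto dest!: fun_cong[of _ _ 0])
qed (transfer; force simp: algebra_simps)+

end

lift_definition scaleC_hinf :: "complex \<Rightarrow> hinf \<Rightarrow> hinf" is "\<lambda>c f z. c * f z"
  by (intro conjI holomorphic_intros bounded_image_mult) (auto simp: bounded_iff)

instantiation hinf :: real_normed_algebra_1
begin

definition scaleR_hinf :: "real \<Rightarrow> hinf \<Rightarrow> hinf" where
  "scaleR_hinf r f = scaleC_hinf (of_real r) f"
definition norm_hinf :: "hinf \<Rightarrow> real" where
  "norm_hinf f = (SUP z\<in>ball 0 1. cmod (hinf_apply f z))"
definition dist_hinf :: "hinf \<Rightarrow> hinf \<Rightarrow> real" where
  "dist_hinf f g = norm (f - g)"
definition sgn_hinf :: "hinf \<Rightarrow> hinf" where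
  "sgn_hinf f = inverse (norm f) *\<^sub>R f"
definition uniformity_hinf :: "(hinf \<times> hinf) filter" where
  "uniformity_hinf = (INF e\<in>{0 <..}. principal {(x, y). dist x y < e})"
definition open_hinf :: "hinf set \<Rightarrow> bool" where
  "open_hinf U = (\<forall>x\<in>U. \<forall>\<^sub>F (x', y) in uniformity. x' = x \<longrightarrow> y \<in> U)"

lemma norm_hinf_upper:
  fixes f :: hinf
  assumes "z \<in> ball 0 1"
  shows "cmod (hinf_apply f z) \<le> norm f"
  unfolding norm_hinf_def
proof (rule cSUP_upper[OF assms])
  have "bounded (hinf_apply f ` ball 0 1)"
    using hinf_apply[of f] by simp
  then show "bdd_above ((\<lambda>z. cmod (hinf_apply f z)) ` ball 0 1)"
    by (auto simp: bounded_iff bdd_above_def)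
qed

lemma norm_hinf_least:
  fixes f :: hinf
  assumes "\<And>z. z \<in> ball 0 1 \<Longrightarrow> cmod (hinf_apply f z) \<le> B"
  shows "norm f \<le> B"
  unfolding norm_hinf_def by (rule cSUP_least) (use assms in auto)

lemma norm_hinf_nonneg: "norm (f::hinf) \<ge> 0"
  using norm_hinf_upper[of 0 f] order_trans[OF norm_ge_zero] by auto

lemma norm_hinf_scaleC_le: "norm (scaleC_hinf c f) \<le> cmod c * norm f"
  by (rule norm_hinf_least)
     (auto simp: scaleC_hinf.rep_eq norm_mult intro!: mult_left_mono norm_hinf_upper)

instance
proof
  fix f g :: hinf and a b :: real
  show "a *\<^sub>R (f + g) = a *\<^sub>R f + a *\<^sub>R g" "(a + b) *\<^sub>R f = a *\<^sub>R f + b *\<^sub>R f"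
       "a *\<^sub>R b *\<^sub>R f = (a * b) *\<^sub>R f" "1 *\<^sub>R f = f"
       "a *\<^sub>R f * g = a *\<^sub>R (f * g)" "f * a *\<^sub>R g = a *\<^sub>R (f * g)"
    unfolding scaleR_hinf_def by (transfer; simp add: algebra_simps)+
  show "norm f = 0 \<longleftrightarrow> f = 0"
  proof
    assume "norm f = 0"
    then have "hinf_apply f z = 0" if "z \<in> ball 0 1" for z
      using norm_hinf_upper[OF that, of f] by simp
    then have "hinf_apply f z = hinf_apply 0 z" for z
      using hinf_apply[of f] by (cases "z \<in> ball 0 1") (auto simp: zero_hinf.rep_eq)
    then show "f = 0"
      by (simp add: hinf_apply_inject[symmetric] fun_eq_iff)
  qed (simp add: norm_hinf_def zero_hinf.rep_eq)
  show "norm (f + g) \<le> norm f + norm g"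
    by (rule norm_hinf_least)
       (auto simp: plus_hinf.rep_eq intro!: norm_triangle_mono norm_hinf_upper)
  show "norm (f * g) \<le> norm f * norm g"
    by (rule norm_hinf_least)
       (auto simp: times_hinf.rep_eq norm_mult intro!: mult_mono norm_hinf_upper norm_hinf_nonneg)
  show "norm (1::hinf) = 1"
    by (simp add: norm_hinf_def one_hinf.rep_eq cong: SUP_cong_simp)
  show "norm (a *\<^sub>R f) = \<bar>a\<bar> * norm f"
  proof (rule antisym)
    show le: "norm (a *\<^sub>R f) \<le> \<bar>a\<bar> * norm f"
      using norm_hinf_scaleC_le[of "of_real a" f] by (simp add: scaleR_hinf_def)
    show "\<bar>a\<bar> * norm f \<le> norm (a *\<^sub>R f)"
    proof (cases "a = 0")
      case False
      have "f = scaleC_hinf (of_real (inverse a)) (a *\<^sub>R f)"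
        unfolding scaleR_hinf_def using False by transfer auto
      then have "norm f \<le> \<bar>inverse a\<bar> * norm (a *\<^sub>R f)"
        using norm_hinf_scaleC_le[of "of_real (inverse a)" "a *\<^sub>R f"] by (simp add: norm_inverse)
      then show ?thesis
        using False by (simp add: field_simps)
    qed (simp add: norm_hinf_nonneg)
  qed
qed (rule dist_hinf_def sgn_hinf_def uniformity_hinf_def open_hinf_def)+

end

instance hinf :: banach
proof
  fix X :: "nat \<Rightarrow> hinf"
  assume X: "Cauchy X"
  define F where "F n z = hinf_apply (X n) z" for n z
  have F: "F n holomorphic_on ball 0 1" "bounded (F n ` ball 0 1)"
    "\<And>z. z \<notin> ball 0 1 \<Longrightarrow> F n z = 0" for n
    using hinf_apply[of "X n"] by (auto simp: F_def[abs_def])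
  have diff: "dist (F m z) (F n z) \<le> dist (X m) (X n)" for m n z
  proof (cases "z \<in> ball 0 1")
    case True
    then show ?thesis
      using norm_hinf_upper[OF True, of "X m - X n"]
      by (simp add: F_def dist_hinf_def minus_hinf.rep_eq dist_norm)
  qed (simp add: F)
  have "\<exists>N. \<forall>m n z. N \<le> m \<and> N \<le> n \<and> True \<longrightarrow> dist (F m z) (F n z) < e" if "e > 0" for e
    using X[unfolded Cauchy_def] that diff by (meson order_le_less_trans)
  then obtain l where l: "\<And>e. e > 0 \<Longrightarrow> \<exists>N. \<forall>n z. N \<le> n \<and> True \<longrightarrow> dist (F n z) (l z) < e"
    using uniformly_convergent_eq_cauchy[of "\<lambda>_. True" F] by blast
  then have ul: "uniform_limit UNIV F l sequentially"
    by (auto simp: uniform_limit_sequentially_iff)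
  have hol: "l holomorphic_on ball 0 1"
  proof (rule holomorphic_uniform_sequence[OF open_ball, of F])
    fix x :: complex assume "x \<in> ball 0 1"
    then obtain d where "d > 0" "cball x d \<subseteq> ball 0 1"
      using open_contains_cball open_ball by blast
    then show "\<exists>d>0. cball x d \<subseteq> ball 0 1 \<and> uniform_limit (cball x d) F l sequentially"
      using uniform_limit_on_subset[OF ul] by blast
  qed (rule F)
  obtain N where N: "\<And>z. dist (F N z) (l z) < 1"
    using l[of 1] by auto
  obtain B where B: "\<And>z. z \<in> ball 0 1 \<Longrightarrow> norm (F N z) \<le> B"
    using F(2)[of N] unfolding bounded_image_iff_norm by blast
  have "norm (l z) \<le> B + 1" if "z \<in> ball 0 1" for z
    using B[OF that] N[of z] norm_triangle_ineq2[of "l z" "F N z"]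
    by (simp add: dist_norm norm_minus_commute)
  then have bdd: "bounded (l ` ball 0 1)"
    unfolding bounded_image_iff_norm by blast
  have zero: "l z = 0" if "z \<notin> ball 0 1" for z
    using tendsto_uniform_limitI[OF ul, of z] by (simp add: F(3)[OF that] LIMSEQ_const_iff)
  obtain L where L: "hinf_apply L = l"
    using hol bdd zero Abs_hinf_inverse[of l] by blast
  have "\<exists>N. \<forall>n\<ge>N. dist (X n) L < e" if e: "e > 0" for e
  proof -
    obtain N where N: "\<And>n z. N \<le> n \<Longrightarrow> dist (F n z) (l z) < e / 2"
      using l[OF half_gt_zero[OF e]] by blast
    have "dist (X n) L \<le> e / 2" if "N \<le> n" for n
      unfolding dist_hinf_def
      by (rule norm_hinf_least)
         (use N[OF that] in \<open>auto simp: minus_hinf.rep_eq L F_def dist_norm intro: less_imp_le\<close>)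
    then show ?thesis
      using e by (intro exI[of _ N] allI impI) (rule order_le_less_trans[of _ "e / 2"], auto)
  qed
  then show "convergent X"
    by (auto simp: convergent_def lim_sequentially)
qed

text \<open>
  The maximal ideal space consists of the nonzero homomorphisms of complex algebras. No continuity
  is required: it is automatic, as such a homomorphism maps \<open>f\<close> to a value of modulus at most
  \<open>norm f\<close>.
\<close>

definition hinf_hom :: "(hinf \<Rightarrow> complex) \<Rightarrow> bool" where
  "hinf_hom \<phi> \<longleftrightarrow>
     (\<forall>f g. \<phi> (f + g) = \<phi> f + \<phi> g) \<and>
     (\<forall>c f. \<phi> (scaleC_hinf c f) = c * \<phi> f) \<and>
     (\<forall>f g. \<phi> (f * g) = \<phi> f * \<phi> g)"

definition max_ideal_space :: "(hinf \<Rightarrow> complex) set" where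
  "max_ideal_space = {\<phi>. hinf_hom \<phi> \<and> (\<exists>f. \<phi> f \<noteq> 0)}"

text \<open>
  The topology that the library puts on a function type is the topology of pointwise convergence;
  its restriction to the maximal ideal space is the weak-* topology.
\<close>

definition max_ideal_topology :: "(hinf \<Rightarrow> complex) topology" where
  "max_ideal_topology = top_of_set max_ideal_space"

definition gelfand :: "hinf \<Rightarrow> (hinf \<Rightarrow> complex) \<Rightarrow> complex" where
  "gelfand f \<phi> = \<phi> f"

text \<open>
  For points of the maximal ideal space the supremum is over a nonempty set of reals bounded by 1.
\<close>

definition gleason_dist :: "(hinf \<Rightarrow> complex) \<Rightarrow> (hinf \<Rightarrow> complex) \<Rightarrow> real" where
  "gleason_dist x y = (SUP f\<in>{f. gelfand f x = 0 \<and> norm f \<le> 1}. cmod (gelfand f y))"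

definition gleason_part :: "(hinf \<Rightarrow> complex) \<Rightarrow> (hinf \<Rightarrow> complex) set" where
  "gleason_part x = {y \<in> max_ideal_space. gleason_dist x y < 1}"

text \<open>
  HOL cannot quantify over the types carrying the auxiliary spaces \<open>W\<close> inside a formula, so that
  type is a parameter. A statement that assumes this for an arbitrary type \<open>'w\<close> covers every space
  of class \<open>\<C>\<close>: choose one \<open>W\<close> for each pair of points and let \<open>'w\<close> be large enough to contain a
  copy of each of them, for instance their disjoint union.
\<close>

definition class_C :: "'w itself \<Rightarrow> 'z topology \<Rightarrow> bool" where
  "class_C _ Z \<longleftrightarrow>
     (\<forall>p\<in>topspace Z. \<forall>q\<in>topspace Z. \<exists>(W :: 'w topology) h.
        connected_space W \<and> first_countable W \<and> t1_space W \<and>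
        continuous_map W Z h \<and> p \<in> h ` topspace W \<and> q \<in> h ` topspace W)"

end

theory Submission
  imports Defs
begin

text \<open>
  The heart of the matter is a statement about sequences: if homomorphisms \<open>\<phi>\<^sub>n\<close> converge to
  \<open>\<phi>\<close> in the maximal ideal space, then they cannot all lie at Gleason distance 1 from \<open>\<phi>\<close>
  (\<open>gleason_close_to_limit\<close>). Given this, in a first-countable space each point has a
  neighbourhood that a continuous map sends into a single Gleason part. As lying in the same part is
  an equivalence relation, the preimages of the parts form a partition into open sets, which is
  trivial when the space is connected; the class \<open>\<C>\<close> reduces the theorem to this case.

  For the statement about sequences, suppose that all the distances are 1. Then for each \<open>n\<close> there
  is \<open>h\<close> in the unit ball that is close to \<open>-1\<close> at \<open>\<phi>\<close> and close to \<open>1\<close> at \<open>\<phi>\<^sub>n\<close>. The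
  functions \<open>F = ((1 + h)/2)\<^sup>2\<close> and \<open>G = ((1 - h)/2)\<^sup>2\<close> satisfy \<open>\<bar>F\<bar> + \<bar>G\<bar> \<le> 1\<close> on the disk, by the
  parallelogram law; here \<open>F\<close> peaks at \<open>\<phi>\<^sub>n\<close> and nearly vanishes at \<open>\<phi>\<close>, and \<open>G\<close> does the opposite.
  Along a sparse subsequence, which is again called \<open>\<phi>\<^sub>k\<close>, the series
  \<open>T = \<Sum>k. c\<^sub>k G\<^sub>0 \<dots> G\<^sub>k\<^sub>-\<^sub>1 F\<^sub>k\<close> is then bounded by 1 whenever \<open>\<bar>c\<^sub>k\<bar> \<le> 1\<close>, and its value at
  \<open>\<phi>\<^sub>k\<close> is nearly \<open>c\<^sub>k\<close>: the earlier \<open>F\<close> nearly vanish there, the earlier \<open>G\<close> are nearly 1,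
  and the tail of the series is divisible by \<open>G\<^sub>k\<close>, which nearly vanishes. The last point is
  essential, as a homomorphism need not respect sums that converge only pointwise on the disk. Alternating \<open>c\<^sub>k\<close>
  contradict the convergence of \<open>\<phi>\<^sub>k T\<close>.
\<close>

section \<open>Bounded holomorphic functions on the disk\<close>

lemma hinf_eqI:
  assumes "\<And>z. z \<in> ball 0 1 \<Longrightarrow> hinf_apply f z = hinf_apply g z"
  shows "f = g"
proof -
  have "hinf_apply f z = hinf_apply g z" for z
    using assms hinf_apply[of f] hinf_apply[of g] by (cases "z \<in> ball 0 1") auto
  then show ?thesis
    by (simp add: hinf_apply_inject[symmetric] fun_eq_iff)
qed

lemma hinf_holomorphic: "hinf_apply f holomorphic_on ball 0 1"
  using hinf_apply[of f] by simp

lemma ex_hinf_of_bounded_holomorphic: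
  assumes "f holomorphic_on ball 0 1" and B: "\<And>z. z \<in> ball 0 1 \<Longrightarrow> cmod (f z) \<le> B"
  shows "\<exists>u. norm u \<le> B \<and> (\<forall>z\<in>ball 0 1. hinf_apply u z = f z)"
proof -
  define g where "g z = (if z \<in> ball 0 1 then f z else 0)" for z
  have "g holomorphic_on ball 0 1"
    by (rule holomorphic_transform[OF assms(1)]) (auto simp: g_def)
  moreover have "bounded (g ` ball 0 1)"
    unfolding bounded_image_iff_norm by (intro exI[of _ B]) (use B in \<open>simp add: g_def\<close>)
  ultimately have u: "hinf_apply (Abs_hinf g) = g"
    by (intro Abs_hinf_inverse) (simp add: g_def)
  have "norm (Abs_hinf g) \<le> B"
    by (rule norm_hinf_least) (auto simp: u g_def intro!: B)
  then show ?thesis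
    using u by (intro exI[of _ "Abs_hinf g"]) (simp add: g_def)
qed

text \<open>
  Montel's theorem replaces a proof of locally uniform convergence: it provides a subsequence with a
  holomorphic limit, and this limit is the given pointwise one.
\<close>

lemma bounded_pointwise_limit_holomorphic:
  fixes S :: "nat \<Rightarrow> complex \<Rightarrow> complex"
  assumes "open D" and hol: "\<And>n. S n holomorphic_on D"
    and bdd: "\<And>n z. z \<in> D \<Longrightarrow> cmod (S n z) \<le> B"
    and lim: "\<And>z. z \<in> D \<Longrightarrow> (\<lambda>n. S n z) \<longlonglongrightarrow> f z"
  shows "f holomorphic_on D"
proof -
  obtain g r where g: "g holomorphic_on D" and r: "strict_mono (r :: nat \<Rightarrow> nat)"
    and gl: "\<And>z. z \<in> D \<Longrightarrow> (\<lambda>n. S (r n) z) \<longlonglongrightarrow> g z"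
  proof (rule Montel[OF \<open>open D\<close>, of "range S" S])
    show "\<exists>B. \<forall>h\<in>range S. \<forall>z\<in>K. cmod (h z) \<le> B" if "K \<subseteq> D" for K
      using bdd that by (intro exI[of _ B]) auto
  qed (use hol in auto)
  have "g z = f z" if "z \<in> D" for z
    using LIMSEQ_unique[OF gl[OF that]] LIMSEQ_subseq_LIMSEQ[OF lim[OF that] r]
    by (simp add: o_def)
  then show ?thesis
    using g holomorphic_transform by blast
qed

lemma hinf_inverse_one_minus:
  fixes g :: hinf
  assumes "norm g < 1"
  shows "\<exists>u. (1 - g) * u = 1"
proof -
  have ge: "1 - norm g \<le> cmod (1 - hinf_apply g z)" if "z \<in> ball 0 1" for z
    using norm_triangle_ineq2[of 1 "hinf_apply g z"] norm_hinf_upper[OF that, of g] by simp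
  have nz: "1 - hinf_apply g z \<noteq> 0" if "z \<in> ball 0 1" for z
    using ge[OF that] assms by auto
  have hol: "(\<lambda>z. 1 / (1 - hinf_apply g z)) holomorphic_on ball 0 1"
    by (intro holomorphic_intros hinf_holomorphic nz)
  have "cmod (1 / (1 - hinf_apply g z)) \<le> 1 / (1 - norm g)" if "z \<in> ball 0 1" for z
    using ge[OF that] assms by (simp add: norm_divide frac_le)
  then obtain u where u: "\<forall>z\<in>ball 0 1. hinf_apply u z = 1 / (1 - hinf_apply g z)"
    using ex_hinf_of_bounded_holomorphic[OF hol] by blast
  have "(1 - g) * u = 1"
    by (rule hinf_eqI) (use u nz in \<open>auto simp: times_hinf.rep_eq minus_hinf.rep_eq one_hinf.rep_eq\<close>)
  then show ?thesis ..
qed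

lemma moebius_norm_identity:
  fixes b w :: complex
  shows "(cmod (1 - cnj b * w))\<^sup>2 - (cmod (w - b))\<^sup>2 = (1 - (cmod b)\<^sup>2) * (1 - (cmod w)\<^sup>2)"
proof -
  have "complex_of_real ((cmod (1 - cnj b * w))\<^sup>2 - (cmod (w - b))\<^sup>2)
      = complex_of_real ((1 - (cmod b)\<^sup>2) * (1 - (cmod w)\<^sup>2))"
    by (simp add: complex_norm_square algebra_simps del: of_real_power)
  then show ?thesis
    using of_real_eq_iff by blast
qed

text \<open>
  Without the division, the equation for \<open>g = (f - b) / (1 - cnj b * f)\<close> can be evaluated at a
  homomorphism.
\<close>

lemma hinf_moebius:
  assumes "norm f \<le> 1" "cmod b < 1"
  shows "\<exists>g. norm g \<le> 1 \<and> g * (1 - scaleC_hinf (cnj b) f) = f - scaleC_hinf b 1"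
proof -
  have "norm (scaleC_hinf (cnj b) f) \<le> cmod b * norm f"
    using norm_hinf_scaleC_le[of "cnj b" f] by simp
  also have "\<dots> \<le> cmod b * 1"
    by (rule mult_left_mono) (use assms in auto)
  finally have "norm (scaleC_hinf (cnj b) f) < 1"
    using assms by simp
  then obtain u where u: "(1 - scaleC_hinf (cnj b) f) * u = 1"
    using hinf_inverse_one_minus by blast
  define g where "g = (f - scaleC_hinf b 1) * u"
  have eq: "g * (1 - scaleC_hinf (cnj b) f) = f - scaleC_hinf b 1"
    using u by (simp add: g_def mult.assoc mult.commute[of u])
  have "cmod (hinf_apply g z) \<le> 1" if z: "z \<in> ball 0 1" for z
  proof -
    define w where "w = hinf_apply f z"
    have "cmod w \<le> 1"
      using norm_hinf_upper[OF z, of f] assms by (simp add: w_def)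
    then have "(cmod w)\<^sup>2 \<le> 1" "(cmod b)\<^sup>2 \<le> 1"
      using assms by (simp_all add: power_le_one)
    then have "(cmod (w - b))\<^sup>2 \<le> (cmod (1 - cnj b * w))\<^sup>2"
      using moebius_norm_identity[of b w] by (smt (verit) mult_nonneg_nonneg)
    then have le: "cmod (w - b) \<le> cmod (1 - cnj b * w)"
      by (rule power2_le_imp_le) simp
    have gz: "hinf_apply g z * (1 - cnj b * w) = w - b"
      using arg_cong[OF eq, of "\<lambda>f. hinf_apply f z"] z
      by (simp add: times_hinf.rep_eq minus_hinf.rep_eq one_hinf.rep_eq scaleC_hinf.rep_eq w_def)
    have "1 - cnj b * w \<noteq> 0"
      using arg_cong[OF u, of "\<lambda>f. hinf_apply f z"] z
      by (auto simp: times_hinf.rep_eq minus_hinf.rep_eq one_hinf.rep_eq scaleC_hinf.rep_eq w_def)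
    then have "hinf_apply g z = (w - b) / (1 - cnj b * w)"
      using gz by (simp add: field_simps)
    then show ?thesis
      using le \<open>1 - cnj b * w \<noteq> 0\<close> by (simp add: norm_divide)
  qed
  then have "norm g \<le> 1"
    by (rule norm_hinf_least)
  then show ?thesis
    using eq by blast
qed

section \<open>Homomorphisms\<close>

context
  fixes x :: "hinf \<Rightarrow> complex"
  assumes x: "x \<in> max_ideal_space"
begin

lemma max_ideal_add: "x (f + g) = x f + x g"
  and max_ideal_scaleC: "x (scaleC_hinf c f) = c * x f"
  and max_ideal_mult: "x (f * g) = x f * x g"
  using x by (auto simp: max_ideal_space_def hinf_hom_def)

lemma max_ideal_one: "x 1 = 1"
proof -
  obtain f where "x f \<noteq> 0"
    using x by (auto simp: max_ideal_space_def)
  then show ?thesis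
    using max_ideal_mult[of f 1] by simp
qed

lemma max_ideal_diff: "x (f - g) = x f - x g"
  using max_ideal_add[of "f - g" g] by simp

text \<open>
  If \<open>\<bar>x f\<bar> > \<parallel>f\<parallel>\<close>, then \<open>1 - f / x f\<close> is invertible, although \<open>x\<close> maps it to 0.
\<close>

lemma max_ideal_norm_le: "cmod (x f) \<le> norm f"
proof (rule ccontr)
  assume *: "\<not> ?thesis"
  then have nz: "x f \<noteq> 0" and less: "norm f < cmod (x f)"
    using norm_hinf_nonneg[of f] by auto
  have "norm (scaleC_hinf (1 / x f) f) \<le> norm f / cmod (x f)"
    using norm_hinf_scaleC_le[of "1 / x f" f] by (simp add: norm_divide)
  also have "\<dots> < 1"
    using less nz by simp
  finally obtain u where "(1 - scaleC_hinf (1 / x f) f) * u = 1"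
    using hinf_inverse_one_minus by blast
  then have "x ((1 - scaleC_hinf (1 / x f) f) * u) = 1"
    by (simp add: max_ideal_one)
  then show False
    using nz by (simp add: max_ideal_mult max_ideal_diff max_ideal_scaleC max_ideal_one)
qed

lemma max_ideal_moebius:
  assumes "g * (1 - scaleC_hinf (cnj b) f) = f - scaleC_hinf b 1"
  shows "x g * (1 - cnj b * x f) = x f - b"
  using arg_cong[OF assms, of x]
  by (simp add: max_ideal_mult max_ideal_diff max_ideal_scaleC max_ideal_one)

end

section \<open>The Gleason distance\<close>

lemma gleason_dist_upper:
  assumes "y \<in> max_ideal_space" "x f = 0" "norm f \<le> 1"
  shows "cmod (y f) \<le> gleason_dist x y"
  unfolding gleason_dist_def
proof (rule cSUP_upper2[of _ _ f])
  show "bdd_above ((\<lambda>f. cmod (gelfand f y)) ` {f. gelfand f x = 0 \<and> norm f \<le> 1})"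
    using max_ideal_norm_le[OF assms(1)] unfolding bdd_above_def gelfand_def
    by (intro exI[of _ 1]) (auto intro: order_trans)
qed (use assms in \<open>auto simp: gelfand_def\<close>)

lemma gleason_dist_least:
  assumes "x \<in> max_ideal_space" "\<And>f. x f = 0 \<Longrightarrow> norm f \<le> 1 \<Longrightarrow> cmod (y f) \<le> B"
  shows "gleason_dist x y \<le> B"
  unfolding gleason_dist_def
proof (rule cSUP_least)
  have "x 0 = 0"
    using max_ideal_diff[OF assms(1), of 0 0] by simp
  then show "{f. gelfand f x = 0 \<and> norm f \<le> 1} \<noteq> {}"
    by (auto simp: gelfand_def intro!: exI[of _ 0])
qed (use assms in \<open>auto simp: gelfand_def\<close>)

lemma gleason_dist_nonneg:
  assumes "x \<in> max_ideal_space" "y \<in> max_ideal_space"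
  shows "0 \<le> gleason_dist x y"
  using gleason_dist_upper[OF assms(2), of x 0] max_ideal_diff[OF assms(1), of 0 0]
  by (auto intro: order_trans[OF norm_ge_zero])

text \<open>
  Composing \<open>f\<close> with the disk automorphism that moves \<open>x f\<close> to 0 exchanges the zero of \<open>f\<close> at
  \<open>y\<close> for a zero at \<open>x\<close>, up to a sign of the value. The automorphism requires \<open>\<bar>x f\<bar> < 1\<close>,
  so it is applied to multiples \<open>t f\<close> with \<open>t < 1\<close>.
\<close>

lemma gleason_dist_sym_le:
  assumes x: "x \<in> max_ideal_space" and y: "y \<in> max_ideal_space"
  shows "gleason_dist y x \<le> gleason_dist x y"
proof (rule gleason_dist_least[OF y])
  fix f assume yf: "y f = 0" and f: "norm f \<le> 1"
  have "t * cmod (x f) \<le> gleason_dist x y" if t: "0 < t" "t < 1" for t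
  proof -
    define k where "k = scaleC_hinf (of_real t) f"
    define b where "b = x k"
    have "norm k \<le> t * norm f"
      using norm_hinf_scaleC_le[of "of_real t" f] t by (simp add: k_def)
    also have "\<dots> \<le> t * 1"
      by (rule mult_left_mono) (use t f in auto)
    finally have k: "norm k \<le> t"
      by simp
    then have "cmod b < 1"
      using max_ideal_norm_le[OF x, of k] t by (simp add: b_def)
    moreover have "norm k \<le> 1"
      using k t by simp
    ultimately obtain g where g: "norm g \<le> 1"
      and eq: "g * (1 - scaleC_hinf (cnj b) k) = k - scaleC_hinf b 1"
      using hinf_moebius by blast
    have "cmod (cnj b * b) \<le> cmod b"
      using mult_left_mono[of "cmod b" 1 "cmod b"] \<open>cmod b < 1\<close> by (simp add: norm_mult)
    then have "1 - cnj b * b \<noteq> 0"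
      using \<open>cmod b < 1\<close> by auto
    then have "x g = 0"
      using max_ideal_moebius[OF x eq] by (simp add: b_def)
    moreover have "y k = 0"
      by (simp add: k_def max_ideal_scaleC[OF y] yf)
    then have "y g = - b"
      using max_ideal_moebius[OF y eq] by simp
    ultimately have "cmod b \<le> gleason_dist x y"
      using gleason_dist_upper[OF y, of x g] g by simp
    then show ?thesis
      using t by (simp add: b_def k_def max_ideal_scaleC[OF x] norm_mult)
  qed
  then show "cmod (x f) \<le> gleason_dist x y"
    by (rule field_le_mult_one_interval)
qed

lemma gleason_less_1_sym:
  assumes "x \<in> max_ideal_space" "y \<in> max_ideal_space" "gleason_dist x y < 1"
  shows "gleason_dist y x < 1"
  using gleason_dist_sym_le[OF assms(1,2)] assms(3) by simp

text \<open>
  Let \<open>f\<close> vanish at \<open>x\<close> and put \<open>b = y f\<close>, so \<open>\<bar>b\<bar> \<le> \<rho>(x, y)\<close>. The function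
  \<open>g = (f - b) / (1 - cnj b * f)\<close> vanishes at \<open>y\<close>, so \<open>\<bar>z g\<bar> \<le> \<rho>(y, z)\<close>, and
  \<open>moebius_norm_identity\<close> with \<open>w = z f\<close> turns this into a bound of \<open>\<bar>z f\<bar>\<close> away from 1.
\<close>

lemma gleason_less_1_trans:
  assumes x: "x \<in> max_ideal_space" and y: "y \<in> max_ideal_space" and z: "z \<in> max_ideal_space"
    and xy: "gleason_dist x y < 1" and yz: "gleason_dist y z < 1"
  shows "gleason_dist x z < 1"
proof -
  define r where "r = gleason_dist x y"
  define s where "s = gleason_dist y z"
  have r: "0 \<le> r" "r < 1" and s: "0 \<le> s" "s < 1"
    using assms gleason_dist_nonneg by (auto simp: r_def s_def)
  define d where "d = (1 - r)\<^sup>2 * (1 - s\<^sup>2)"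
  have "s\<^sup>2 < 1" "0 < (1 - r)\<^sup>2"
    using r s by (simp_all add: power_less_one_iff abs_square_less_1)
  then have d: "0 < d"
    by (simp add: d_def)
  have "gleason_dist x z \<le> sqrt (1 - d)"
  proof (rule gleason_dist_least[OF x])
    fix f assume xf: "x f = 0" and f: "norm f \<le> 1"
    define b where "b = y f"
    define w where "w = z f"
    have b: "cmod b \<le> r"
      using gleason_dist_upper[OF y, of x f] xf f by (simp add: b_def r_def)
    have w: "cmod w \<le> 1"
      using max_ideal_norm_le[OF z, of f] f by (simp add: w_def)
    obtain g where g: "norm g \<le> 1" and eq: "g * (1 - scaleC_hinf (cnj b) f) = f - scaleC_hinf b 1"
      using hinf_moebius[OF f, of b] b r by auto
    have bw: "cmod (cnj b * w) \<le> r"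
      using mult_mono[OF b w] r by (simp add: norm_mult)
    have bb: "cmod (cnj b * b) \<le> r"
      using mult_mono[OF b, of "cmod b" 1] b r by (simp add: norm_mult)
    then have "1 - cnj b * b \<noteq> 0"
      using r by auto
    then have "y g = 0"
      using max_ideal_moebius[OF y eq] by (simp add: b_def)
    then have zg: "cmod (z g) \<le> s"
      using gleason_dist_upper[OF z, of y g] g by (simp add: s_def)
    define p where "p = (cmod (1 - cnj b * w))\<^sup>2"
    have "1 - r \<le> cmod (1 - cnj b * w)"
      using norm_triangle_ineq2[of 1 "cnj b * w"] bw by simp
    then have p: "(1 - r)\<^sup>2 \<le> p"
      using r by (simp add: p_def power_mono)
    have "w - b = z g * (1 - cnj b * w)"
      using max_ideal_moebius[OF z eq] by (simp add: w_def)
    then have "(cmod (w - b))\<^sup>2 = (cmod (z g))\<^sup>2 * p"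
      by (simp add: norm_mult power_mult_distrib p_def)
    moreover have "(cmod (z g))\<^sup>2 * p \<le> s\<^sup>2 * p"
      by (intro mult_right_mono power_mono zg) (auto simp: p_def)
    ultimately have "p * (1 - s\<^sup>2) \<le> (1 - (cmod b)\<^sup>2) * (1 - (cmod w)\<^sup>2)"
      using moebius_norm_identity[of b w] by (simp add: p_def algebra_simps)
    also have "\<dots> \<le> 1 * (1 - (cmod w)\<^sup>2)"
      by (rule mult_right_mono) (use w in \<open>auto simp: power_le_one\<close>)
    finally have "p * (1 - s\<^sup>2) \<le> 1 - (cmod w)\<^sup>2"
      by simp
    moreover have "d \<le> p * (1 - s\<^sup>2)"
      unfolding d_def using p \<open>s\<^sup>2 < 1\<close> by (intro mult_right_mono) auto
    ultimately have "(cmod w)\<^sup>2 \<le> 1 - d"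
      by simp
    then show "cmod (z f) \<le> sqrt (1 - d)"
      by (simp add: w_def real_le_rsqrt)
  qed
  also have "\<dots> < 1"
    using d by (simp add: real_sqrt_lt_1_iff)
  finally show ?thesis .
qed

section \<open>Separating homomorphisms at distance 1\<close>

text \<open>
  A function vanishing at \<open>x\<close> has a value \<open>t\<close> at \<open>y\<close> that is as close to 1 as needed. The
  automorphism \<open>w \<mapsto> (w - a)/(1 - a w)\<close> with \<open>a = 1 - d\<close> sends 0 to \<open>-a\<close> and, when
  \<open>1 - t\<close> is much smaller than \<open>d\<close>, it sends \<open>t\<close> close to 1.
\<close>

lemma ex_separating_function:
  assumes x: "x \<in> max_ideal_space" and y: "y \<in> max_ideal_space"
    and far: "\<not> gleason_dist x y < 1" and e: "0 < e"
  shows "\<exists>h. norm h \<le> 1 \<and> cmod (1 + x h) \<le> e \<and> cmod (1 - y h) \<le> e"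
proof -
  define d :: real where "d = min e (1/2)"
  have d: "0 < d" "d \<le> e" "d < 1"
    using e by (auto simp: d_def)
  have d2: "d\<^sup>2 / 2 < 1"
    using d power_le_one[of d 2] by simp
  have "\<exists>f. x f = 0 \<and> norm f \<le> 1 \<and> 1 - d\<^sup>2 / 2 < cmod (y f)"
  proof (rule ccontr)
    assume "\<not> ?thesis"
    then have "gleason_dist x y \<le> 1 - d\<^sup>2 / 2"
      by (intro gleason_dist_least[OF x]) force
    then show False
      using far d by (smt (verit) zero_less_power half_gt_zero)
  qed
  then obtain f0 where f0: "x f0 = 0" "norm f0 \<le> 1" "1 - d\<^sup>2 / 2 < cmod (y f0)"
    by blast
  define t where "t = cmod (y f0)"
  have t: "1 - d\<^sup>2 / 2 < t" "0 < t" "t \<le> 1"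
    using f0 d2 max_ideal_norm_le[OF y, of f0] unfolding t_def by linarith+
  define f where "f = scaleC_hinf (cnj (y f0) / of_real t) f0"
  have xf: "x f = 0"
    by (simp add: f_def max_ideal_scaleC[OF x] f0)
  have "y f = y f0 * cnj (y f0) / of_real t"
    by (simp add: f_def max_ideal_scaleC[OF y])
  also have "\<dots> = of_real t"
    using t by (simp add: t_def complex_norm_square[symmetric] power2_eq_square)
  finally have yf: "y f = of_real t" .
  have "norm f \<le> cmod (cnj (y f0) / of_real t) * norm f0"
    unfolding f_def by (rule norm_hinf_scaleC_le)
  then have f: "norm f \<le> 1"
    using t f0 by (simp add: norm_divide t_def)
  define a where "a = 1 - d"
  have a: "0 < a" "a < 1"
    using d by (auto simp: a_def)
  obtain h where h: "norm h \<le> 1"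
    and eq: "h * (1 - scaleC_hinf (cnj (of_real a)) f) = f - scaleC_hinf (of_real a) 1"
    using hinf_moebius[OF f, of "of_real a"] a by auto
  have "x h = - of_real a"
    using max_ideal_moebius[OF x eq] xf by simp
  then have "1 + x h = of_real d"
    by (simp add: a_def)
  then have 1: "cmod (1 + x h) \<le> e"
    using d by simp
  have "(1 - y h) * of_real (1 - a * t) = of_real ((1 + a) * (1 - t))"
    using max_ideal_moebius[OF y eq] yf by (simp add: algebra_simps)
  then have "cmod (1 - y h) * \<bar>1 - a * t\<bar> = \<bar>(1 + a) * (1 - t)\<bar>"
    by (metis norm_mult norm_of_real)
  moreover have "a * t \<le> a * 1"
    by (rule mult_left_mono) (use a t in auto)
  then have at: "d \<le> 1 - a * t"
    by (simp add: a_def)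
  ultimately have "cmod (1 - y h) * (1 - a * t) = (1 + a) * (1 - t)"
    using d a t by (simp add: abs_mult)
  also have "\<dots> \<le> 2 * (1 - t)"
    by (rule mult_right_mono) (use a t in auto)
  also have "\<dots> \<le> d * d"
    using t by (simp add: power2_eq_square)
  finally have "cmod (1 - y h) * d \<le> d * d"
    using mult_left_mono[OF at, of "cmod (1 - y h)"] by simp
  then have 2: "cmod (1 - y h) \<le> e"
    using d by simp
  show ?thesis
    using h 1 2 by blast
qed

definition complementary :: "hinf \<Rightarrow> hinf \<Rightarrow> bool" where
  "complementary F G \<longleftrightarrow> (\<forall>z\<in>ball 0 1. cmod (hinf_apply F z) + cmod (hinf_apply G z) \<le> 1)"

text \<open>
  The squares make the parallelogram law applicable:
  \<open>\<bar>(1 + w)/2\<bar>\<^sup>2 + \<bar>(1 - w)/2\<bar>\<^sup>2 = (1 + \<bar>w\<bar>\<^sup>2)/2\<close>.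
\<close>

lemma ex_complementary_peaks:
  assumes x: "x \<in> max_ideal_space" and y: "y \<in> max_ideal_space"
    and far: "\<not> gleason_dist x y < 1" and e: "0 < e"
  shows "\<exists>F G. complementary F G \<and> cmod (x F) \<le> e \<and> cmod (x G - 1) \<le> e
                 \<and> cmod (y F - 1) \<le> e \<and> cmod (y G) \<le> e"
proof -
  obtain h where h: "norm h \<le> 1" "cmod (1 + x h) \<le> e" "cmod (1 - y h) \<le> e"
    using ex_separating_function[OF assms] by blast
  define P where "P = scaleC_hinf (1/2) (1 + h)"
  define Q where "Q = scaleC_hinf (1/2) (1 - h)"
  have "cmod (hinf_apply (P * P) z) + cmod (hinf_apply (Q * Q) z) \<le> 1" if z: "z \<in> ball 0 1" for z
  proof -
    define w where "w = hinf_apply h z"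
    have "cmod w \<le> 1"
      using norm_hinf_upper[OF z, of h] h by (simp add: w_def)
    then have w: "(cmod w)\<^sup>2 \<le> 1"
      by (simp add: power_le_one)
    have "cmod (hinf_apply (P * P) z) + cmod (hinf_apply (Q * Q) z)
        = ((cmod (1 + w))\<^sup>2 + (cmod (1 - w))\<^sup>2) / 4"
      using z by (simp add: P_def Q_def times_hinf.rep_eq scaleC_hinf.rep_eq plus_hinf.rep_eq
          minus_hinf.rep_eq one_hinf.rep_eq w_def norm_mult norm_divide power2_eq_square)
    also have "(cmod (1 + w))\<^sup>2 + (cmod (1 - w))\<^sup>2 = 2 + 2 * (cmod w)\<^sup>2"
      by (simp add: cmod_power2) (simp add: power2_eq_square algebra_simps)
    finally show ?thesis
      using w by simp
  qed
  then have comp: "complementary (P * P) (Q * Q)"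
    by (simp add: complementary_def)
  have val: "u (P * P) = ((1 + u h) / 2)\<^sup>2 \<and> u (Q * Q) = ((1 - u h) / 2)\<^sup>2"
    if u: "u \<in> max_ideal_space" for u
    by (simp add: P_def Q_def max_ideal_mult[OF u] max_ideal_scaleC[OF u] max_ideal_add[OF u]
        max_ideal_diff[OF u] max_ideal_one[OF u] power2_eq_square)
  have near0: "cmod ((v / 2)\<^sup>2) \<le> e" and near1: "cmod (((2 - v) / 2)\<^sup>2 - 1) \<le> e"
    if "cmod v \<le> e" "cmod v \<le> 2" "cmod (2 - v) \<le> 2" for v
  proof -
    have "cmod v * cmod v \<le> e * 2"
      using that e by (intro mult_mono) auto
    then show "cmod ((v / 2)\<^sup>2) \<le> e"
      using e by (simp add: norm_power norm_divide power_divide power2_eq_square norm_mult)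
    have eq: "((2 - v) / 2)\<^sup>2 - 1 = v * (v - 4) / 4"
      by (simp add: power2_eq_square field_simps)
    have "cmod (v - 4) \<le> 4"
      using norm_triangle_ineq[of "v - 2" "-2"] that norm_minus_commute[of v 2] by simp
    then have "cmod v * cmod (v - 4) \<le> e * 4"
      using that e by (intro mult_mono) auto
    then show "cmod (((2 - v) / 2)\<^sup>2 - 1) \<le> e"
      unfolding eq by (simp add: norm_mult norm_divide)
  qed
  have bd: "cmod (1 + u h) \<le> 2" "cmod (1 - u h) \<le> 2" if "u \<in> max_ideal_space" for u
    using max_ideal_norm_le[OF that, of h] h norm_triangle_ineq[of 1 "u h"]
      norm_triangle_ineq4[of 1 "u h"] by auto
  have "cmod (x (P * P)) \<le> e" "cmod (x (Q * Q) - 1) \<le> e"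
    using near0[of "1 + x h"] near1[of "1 + x h"] h bd[OF x] val[OF x] by auto
  moreover have "cmod (y (P * P) - 1) \<le> e" "cmod (y (Q * Q)) \<le> e"
    using near0[of "1 - y h"] near1[of "1 - y h"] h bd[OF y] val[OF y] by auto
  ultimately show ?thesis
    using comp by blast
qed

section \<open>Series of complementary functions\<close>

text \<open>
  For numbers \<open>\<alpha>\<^sub>i + \<beta>\<^sub>i \<le> 1\<close> the sum telescopes, as \<open>\<alpha>\<^sub>i \<Prod>\<beta> \<le> (1 - \<beta>\<^sub>i) \<Prod>\<beta>\<close>.
\<close>

lemma sum_mult_prod_le_1:
  fixes \<alpha> \<beta> :: "nat \<Rightarrow> real"
  assumes "\<And>i. 0 \<le> \<beta> i" "\<And>i. \<alpha> i + \<beta> i \<le> 1"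
  shows "(\<Sum>i<n. \<alpha> i * (\<Prod>j<i. \<beta> j)) \<le> 1 - (\<Prod>j<n. \<beta> j)"
proof (induction n)
  case (Suc n)
  have "\<alpha> n * (\<Prod>j<n. \<beta> j) \<le> (1 - \<beta> n) * (\<Prod>j<n. \<beta> j)"
    using assms(2)[of n] assms(1) by (intro mult_right_mono prod_nonneg) (auto simp: algebra_simps)
  then show ?case
    using Suc by (simp add: algebra_simps)
qed simp

text \<open>
  \<open>T k\<close> is the series \<open>\<Sum>i. c (k + i) * F (k + i) * G k * \<dots> * G (k + i - 1)\<close>. Its
  recursion is what survives the application of a homomorphism.
\<close>

lemma ex_complementary_series:
  fixes F G :: "nat \<Rightarrow> hinf" and c :: "nat \<Rightarrow> complex"
  assumes FG: "\<And>k. complementary (F k) (G k)" and c: "\<And>k. cmod (c k) \<le> 1"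
  shows "\<exists>T. \<forall>k. norm (T k) \<le> 1 \<and> T k = scaleC_hinf (c k) (F k) + G k * T (Suc k)"
proof -
  define A where "A k i z = c (k + i) * hinf_apply (F (k + i)) z * (\<Prod>j<i. hinf_apply (G (k + j)) z)"
    for k i z
  have sum_norm: "(\<Sum>i<n. cmod (A k i z)) \<le> 1" if z: "z \<in> ball 0 1" for k n z
  proof -
    define \<beta> where "\<beta> j = cmod (hinf_apply (G (k + j)) z)" for j
    have "cmod (A k i z) \<le> cmod (hinf_apply (F (k + i)) z) * (\<Prod>j<i. \<beta> j)" for i
    proof -
      have "cmod (A k i z) = cmod (c (k + i)) * (cmod (hinf_apply (F (k + i)) z) * (\<Prod>j<i. \<beta> j))"
        by (simp add: A_def norm_mult \<beta>_def prod_norm)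
      also have "\<dots> \<le> 1 * (cmod (hinf_apply (F (k + i)) z) * (\<Prod>j<i. \<beta> j))"
        by (intro mult_right_mono c mult_nonneg_nonneg prod_nonneg) (auto simp: \<beta>_def)
      finally show ?thesis
        by simp
    qed
    then have "(\<Sum>i<n. cmod (A k i z)) \<le> (\<Sum>i<n. cmod (hinf_apply (F (k + i)) z) * (\<Prod>j<i. \<beta> j))"
      by (intro sum_mono)
    also have "\<dots> \<le> 1 - (\<Prod>j<n. \<beta> j)"
      by (rule sum_mult_prod_le_1) (use FG z in \<open>auto simp: \<beta>_def complementary_def\<close>)
    also have "\<dots> \<le> 1"
      by (simp add: prod_nonneg \<beta>_def)
    finally show ?thesis .
  qed
  have summ: "summable (\<lambda>i. A k i z)" if z: "z \<in> ball 0 1" for k z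
    by (rule summable_norm_cancel, rule summableI_nonneg_bounded) (use sum_norm[OF z] in auto)
  have partial: "cmod (\<Sum>i<n. A k i z) \<le> 1" if "z \<in> ball 0 1" for k n z
    using norm_sum sum_norm[OF that] by (rule order_trans)
  have lim: "(\<lambda>n. \<Sum>i<n. A k i z) \<longlonglongrightarrow> (\<Sum>i. A k i z)" if "z \<in> ball 0 1" for k z
    using summ[OF that] by (rule summable_LIMSEQ)
  have "(\<lambda>z. \<Sum>i. A k i z) holomorphic_on ball 0 1" for k
  proof (rule bounded_pointwise_limit_holomorphic[OF open_ball _ partial lim])
    show "(\<lambda>z. \<Sum>i<n. A k i z) holomorphic_on ball 0 1" for n
      unfolding A_def by (intro holomorphic_intros hinf_holomorphic)
  qed
  moreover have "cmod (\<Sum>i. A k i z) \<le> 1" if "z \<in> ball 0 1" for k z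
    by (rule Lim_norm_ubound[OF _ lim[OF that]]) (use partial[OF that] in auto)
  ultimately have "\<exists>u. norm u \<le> 1 \<and> (\<forall>z\<in>ball 0 1. hinf_apply u z = (\<Sum>i. A k i z))" for k
    by (intro ex_hinf_of_bounded_holomorphic) auto
  then obtain T where T: "\<And>k. norm (T k) \<le> 1"
    "\<And>k z. z \<in> ball 0 1 \<Longrightarrow> hinf_apply (T k) z = (\<Sum>i. A k i z)"
    by metis
  have "T k = scaleC_hinf (c k) (F k) + G k * T (Suc k)" for k
  proof (rule hinf_eqI)
    fix z :: complex assume z: "z \<in> ball 0 1"
    have shift: "A k (Suc i) z = hinf_apply (G k) z * A (Suc k) i z" for i
      by (simp add: A_def prod.lessThan_Suc_shift del: prod.lessThan_Suc)
    have "(\<Sum>i. A k i z) = A k 0 z + (\<Sum>i. A k (Suc i) z)"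
      using suminf_split_head[OF summ[OF z]] by simp
    also have "(\<Sum>i. A k (Suc i) z) = hinf_apply (G k) z * (\<Sum>i. A (Suc k) i z)"
      unfolding shift by (rule suminf_mult[OF summ[OF z]])
    finally show "hinf_apply (T k) z = hinf_apply (scaleC_hinf (c k) (F k) + G k * T (Suc k)) z"
      using z by (simp add: T plus_hinf.rep_eq times_hinf.rep_eq scaleC_hinf.rep_eq A_def)
  qed
  then show ?thesis
    using T by blast
qed

text \<open>
  The errors at the homomorphism \<open>\<psi> j\<close> are at most \<open>2 * \<epsilon> k\<close> for each step \<open>k \<le> j\<close> of the
  recursion. For \<open>k < j\<close> the step changes \<open>\<psi> j (T k)\<close> little; at \<open>k = j\<close> the value \<open>c j\<close> is
  read off, and the remaining tail is suppressed by \<open>\<psi> j (G j)\<close>.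
\<close>

lemma ex_prescribed_values:
  fixes \<psi> :: "nat \<Rightarrow> hinf \<Rightarrow> complex" and c :: "nat \<Rightarrow> complex" and \<epsilon> :: "nat \<Rightarrow> real"
  assumes \<psi>: "\<And>k. \<psi> k \<in> max_ideal_space"
    and FG: "\<And>k. complementary (F k) (G k)" and c: "\<And>k. cmod (c k) \<le> 1"
    and peak: "\<And>k. cmod (\<psi> k (F k) - 1) \<le> \<epsilon> k" "\<And>k. cmod (\<psi> k (G k)) \<le> \<epsilon> k"
    and later: "\<And>k j. k < j \<Longrightarrow> cmod (\<psi> j (F k)) \<le> \<epsilon> k"
      "\<And>k j. k < j \<Longrightarrow> cmod (\<psi> j (G k) - 1) \<le> \<epsilon> k"
  shows "\<exists>T. \<forall>j. cmod (\<psi> j T - c j) \<le> 2 * (\<Sum>k\<le>j. \<epsilon> k)"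
proof -
  obtain T where nT: "\<And>k. norm (T k) \<le> 1"
    and T: "\<And>k. T k = scaleC_hinf (c k) (F k) + G k * T (Suc k)"
    using ex_complementary_series[of F G c, OF FG c] by blast
  have bT: "cmod (\<psi> j (T k)) \<le> 1" for j k
    using max_ideal_norm_le[OF \<psi>, of j "T k"] nT[of k] by simp
  have le: "cmod (a * p + q * b) \<le> 2 * e" if "cmod a \<le> 1" "cmod b \<le> 1" "cmod p \<le> e" "cmod q \<le> e"
    for a b p q e
  proof -
    have "0 \<le> e"
      using that(3) norm_ge_zero order_trans by blast
    then have "cmod a * cmod p \<le> 1 * e" "cmod q * cmod b \<le> e * 1"
      using that by (intro mult_mono; simp)+
    then show ?thesis
      using norm_triangle_ineq[of "a * p" "q * b"] by (simp add: norm_mult)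
  qed
  have rec: "\<psi> j (T k) = c k * \<psi> j (F k) + \<psi> j (G k) * \<psi> j (T (Suc k))" for j k
    by (subst T) (simp add: max_ideal_add[OF \<psi>] max_ideal_mult[OF \<psi>] max_ideal_scaleC[OF \<psi>])
  have "cmod (\<psi> j (T k) - c j) \<le> 2 * (\<Sum>i=k..j. \<epsilon> i)" if "k \<le> j" for j k
    using that
  proof (induction k rule: inc_induct)
    case base
    have "\<psi> j (T j) - c j = c j * (\<psi> j (F j) - 1) + \<psi> j (G j) * \<psi> j (T (Suc j))"
      by (simp add: rec[of j j] algebra_simps)
    then show ?case
      using le[OF c bT peak] by simp
  next
    case (step k)
    have "\<psi> j (T k) - \<psi> j (T (Suc k))
        = c k * \<psi> j (F k) + (\<psi> j (G k) - 1) * \<psi> j (T (Suc k))"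
      by (simp add: rec[of j k] algebra_simps)
    then have "cmod (\<psi> j (T k) - \<psi> j (T (Suc k))) \<le> 2 * \<epsilon> k"
      using le[OF c bT later] step.hyps by simp
    moreover have "(\<Sum>i=k..j. \<epsilon> i) = \<epsilon> k + (\<Sum>i=Suc k..j. \<epsilon> i)"
      using step.hyps by (simp add: sum.atLeast_Suc_atMost)
    ultimately show ?case
      using step.IH norm_triangle_ineq[of "\<psi> j (T k) - \<psi> j (T (Suc k))" "\<psi> j (T (Suc k)) - c j"]
      by simp
  qed
  then have "cmod (\<psi> j (T 0) - c j) \<le> 2 * (\<Sum>k\<le>j. \<epsilon> k)" for j
    by (simp add: atMost_atLeast0)
  then show ?thesis
    by blast
qed

section \<open>Convergent sequences and Gleason parts\<close>

lemma gleason_close_to_limit: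
  fixes \<phi> :: "nat \<Rightarrow> hinf \<Rightarrow> complex"
  assumes x: "x \<in> max_ideal_space" and \<phi>: "\<And>n. \<phi> n \<in> max_ideal_space"
    and lim: "\<And>f. (\<lambda>n. \<phi> n f) \<longlonglongrightarrow> x f"
  shows "\<exists>n. gleason_dist x (\<phi> n) < 1"
proof (rule ccontr)
  assume "\<not> ?thesis"
  then have far: "\<not> gleason_dist x (\<phi> n) < 1" for n
    by blast
  \<comment> \<open>The constant makes the total error \<open>2 * \<Sum>k. \<epsilon> k = 1/4\<close> smaller than half of the
      distance 1 between the prescribed values 0 and 1.\<close>
  define \<epsilon> :: "nat \<Rightarrow> real" where "\<epsilon> n = (1/2) ^ n / 16" for n
  have \<epsilon>: "0 < \<epsilon> n" for n
    by (simp add: \<epsilon>_def)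
  have "\<exists>F G. complementary F G \<and> cmod (x F) \<le> \<epsilon> n / 2 \<and> cmod (x G - 1) \<le> \<epsilon> n / 2
               \<and> cmod (\<phi> n F - 1) \<le> \<epsilon> n / 2 \<and> cmod (\<phi> n G) \<le> \<epsilon> n / 2" for n
    by (rule ex_complementary_peaks[OF x \<phi> far]) (simp add: \<epsilon>)
  then obtain F G where FG: "\<And>n. complementary (F n) (G n)"
    and xF: "\<And>n. cmod (x (F n)) \<le> \<epsilon> n / 2" and xG: "\<And>n. cmod (x (G n) - 1) \<le> \<epsilon> n / 2"
    and pF: "\<And>n. cmod (\<phi> n (F n) - 1) \<le> \<epsilon> n / 2" and pG: "\<And>n. cmod (\<phi> n (G n)) \<le> \<epsilon> n / 2"
    by metis
  have "\<exists>N>n. \<forall>m\<ge>N. cmod (\<phi> m (F n)) \<le> \<epsilon> n \<and> cmod (\<phi> m (G n) - 1) \<le> \<epsilon> n" for n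
  proof -
    have "\<forall>\<^sub>F m in sequentially. dist (\<phi> m (F n)) (x (F n)) < \<epsilon> n / 2 \<and>
        dist (\<phi> m (G n)) (x (G n)) < \<epsilon> n / 2"
      using lim[of "F n"] lim[of "G n"] \<epsilon>[of n] by (intro eventually_conj tendstoD) auto
    then obtain N where N: "\<And>m. m \<ge> N \<Longrightarrow> cmod (\<phi> m (F n) - x (F n)) < \<epsilon> n / 2"
      "\<And>m. m \<ge> N \<Longrightarrow> cmod (\<phi> m (G n) - x (G n)) < \<epsilon> n / 2"
      unfolding eventually_sequentially dist_norm by blast
    have "cmod (\<phi> m (F n)) \<le> \<epsilon> n \<and> cmod (\<phi> m (G n) - 1) \<le> \<epsilon> n" if "m \<ge> N" for m
      using N[OF that] xF[of n] xG[of n]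
        norm_triangle_ineq[of "\<phi> m (F n) - x (F n)" "x (F n)"]
        norm_triangle_ineq[of "\<phi> m (G n) - x (G n)" "x (G n) - 1"] by simp
    then show ?thesis
      by (intro exI[of _ "max N (Suc n)"]) auto
  qed
  then obtain N where N: "\<And>n. N n > n"
    and NF: "\<And>n m. m \<ge> N n \<Longrightarrow> cmod (\<phi> m (F n)) \<le> \<epsilon> n"
    and NG: "\<And>n m. m \<ge> N n \<Longrightarrow> cmod (\<phi> m (G n) - 1) \<le> \<epsilon> n"
    by metis
  define r where "r k = (N ^^ k) 0" for k
  have rSuc: "r (Suc k) = N (r k)" for k
    by (simp add: r_def)
  then have r: "strict_mono r"
    using N by (simp add: strict_mono_Suc_iff)
  have rN: "N (r k) \<le> r j" if "k < j" for k j
    using that strict_mono_less_eq[OF r, of "Suc k" j] by (simp add: rSuc)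
  have \<epsilon>r: "\<epsilon> (r k) \<le> \<epsilon> k" for k
    using seq_suble[OF r, of k] by (auto simp: \<epsilon>_def intro: power_decreasing)
  define c :: "nat \<Rightarrow> complex" where "c k = of_bool (even k)" for k
  have "\<exists>T. \<forall>j. cmod (\<phi> (r j) T - c j) \<le> 2 * (\<Sum>k\<le>j. \<epsilon> k)"
  proof (rule ex_prescribed_values[where F = "F \<circ> r" and G = "G \<circ> r"])
    show "cmod (\<phi> (r k) ((F \<circ> r) k) - 1) \<le> \<epsilon> k" "cmod (\<phi> (r k) ((G \<circ> r) k)) \<le> \<epsilon> k" for k
      using pF[of "r k"] pG[of "r k"] \<epsilon>r[of k] \<epsilon>[of "r k"] by auto
    show "cmod (\<phi> (r j) ((F \<circ> r) k)) \<le> \<epsilon> k" "cmod (\<phi> (r j) ((G \<circ> r) k) - 1) \<le> \<epsilon> k"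
      if "k < j" for k j
      using NF[OF rN[OF that]] NG[OF rN[OF that]] \<epsilon>r[of k] by auto
  qed (auto simp: \<phi> FG c_def)
  then obtain T where T: "\<And>j. cmod (\<phi> (r j) T - c j) \<le> 2 * (\<Sum>k\<le>j. \<epsilon> k)"
    by blast
  have "2 * (\<Sum>k\<le>j. \<epsilon> k) \<le> 1/4" for j
  proof -
    have "(\<Sum>k\<le>j. \<epsilon> k) = 1/8 - \<epsilon> j"
      by (induction j) (simp_all add: \<epsilon>_def)
    then show ?thesis
      using \<epsilon>[of j] by simp
  qed
  then have near: "cmod (\<phi> (r j) T - c j) \<le> 1/4" for j
    using T order_trans by blast
  have "(\<lambda>j. \<phi> (r j) T) \<longlonglongrightarrow> x T"
    using LIMSEQ_subseq_LIMSEQ[OF lim r] by (simp add: o_def)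
  then obtain J where J: "\<And>j. j \<ge> J \<Longrightarrow> cmod (\<phi> (r j) T - x T) < 1/4"
    using LIMSEQ_D[of _ "x T" "1/4"] by auto
  have "cmod (x T - c j) < 1/2" if "j \<ge> J" for j
    using J[OF that] near[of j] norm_triangle_ineq[of "x T - \<phi> (r j) T" "\<phi> (r j) T - c j"]
      norm_minus_commute[of "x T"] by simp
  from this[of "2 * J"] this[of "Suc (2 * J)"] have "cmod (x T - 1) < 1/2" "cmod (x T) < 1/2"
    by (auto simp: c_def)
  then show False
    using norm_triangle_ineq4[of "x T" "x T - 1"] by simp
qed

lemma continuous_map_max_idealD:
  assumes "continuous_map W max_ideal_topology \<Phi>"
  shows "w \<in> topspace W \<Longrightarrow> \<Phi> w \<in> max_ideal_space"
    and "continuous_map W euclidean (\<lambda>w. \<Phi> w f)"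
proof -
  have *: "continuous_map W euclidean \<Phi>" "\<Phi> \<in> topspace W \<rightarrow> max_ideal_space"
    using assms by (auto simp: max_ideal_topology_def continuous_map_in_subtopology)
  then show "w \<in> topspace W \<Longrightarrow> \<Phi> w \<in> max_ideal_space"
    by auto
  have "continuous_map euclidean euclidean (\<lambda>\<phi>::hinf \<Rightarrow> complex. \<phi> f)"
    by simp
  then show "continuous_map W euclidean (\<lambda>w. \<Phi> w f)"
    using continuous_map_compose[OF *(1), of euclidean "\<lambda>\<phi>. \<phi> f"] by (simp add: o_def)
qed

text \<open>
  Otherwise each member of a decreasing countable neighbourhood base contains a point whose image
  lies at distance 1 from that of \<open>w\<close>, although these images converge to it.
\<close>

lemma locally_in_gleason_part:
  assumes W: "first_countable W" and \<Phi>: "continuous_map W max_ideal_topology \<Phi>"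
    and w: "w \<in> topspace W"
  shows "\<exists>U. openin W U \<and> w \<in> U \<and> (\<forall>u\<in>U. gleason_dist (\<Phi> w) (\<Phi> u) < 1)"
proof (rule ccontr)
  assume none: "\<not> ?thesis"
  obtain \<B> where cB: "countable \<B>" and oB: "\<And>V. V \<in> \<B> \<Longrightarrow> openin W V"
    and nb: "\<And>U. openin W U \<Longrightarrow> w \<in> U \<Longrightarrow> \<exists>V\<in>\<B>. w \<in> V \<and> V \<subseteq> U"
    using W w unfolding first_countable_def by metis
  define \<C> where "\<C> = {V \<in> \<B>. w \<in> V}"
  have "countable \<C>" "\<C> \<noteq> {}"
    using cB nb[OF openin_topspace w] by (auto simp: \<C>_def)
  define V where "V = from_nat_into \<C>"
  have V: "V n \<in> \<C>" for n
    using from_nat_into[OF \<open>\<C> \<noteq> {}\<close>] by (simp add: V_def)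
  define U where "U n = (\<Inter>i\<le>n. V i)" for n
  have "openin W (U n)" "w \<in> U n" for n
    using V oB by (auto simp: U_def \<C>_def intro!: openin_Inter)
  then have "\<exists>u\<in>U n. \<not> gleason_dist (\<Phi> w) (\<Phi> u) < 1" for n
    using none by blast
  then obtain u where u: "\<And>n. u n \<in> U n" "\<And>n. \<not> gleason_dist (\<Phi> w) (\<Phi> (u n)) < 1"
    by metis
  have uW: "u n \<in> topspace W" for n
    using u(1)[of n] \<open>openin W (U n)\<close> openin_subset by blast
  have "(\<lambda>n. \<Phi> (u n) f) \<longlonglongrightarrow> \<Phi> w f" for f
  proof (rule topological_tendstoI)
    fix S assume S: "open S" "\<Phi> w f \<in> S"
    have "openin W {v \<in> topspace W. \<Phi> v f \<in> S}"
      using openin_continuous_map_preimage[OF continuous_map_max_idealD(2)[OF \<Phi>]] S by simp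
    then obtain V0 where V0: "V0 \<in> \<C>" "V0 \<subseteq> {v \<in> topspace W. \<Phi> v f \<in> S}"
      using nb[of "{v \<in> topspace W. \<Phi> v f \<in> S}"] w S by (auto simp: \<C>_def)
    then obtain i where "V0 = V i"
      using from_nat_into_surj[OF \<open>countable \<C>\<close>] unfolding V_def by metis
    then have "\<Phi> (u n) f \<in> S" if "n \<ge> i" for n
      using u(1)[of n] V0 that by (auto simp: U_def)
    then show "\<forall>\<^sub>F n in sequentially. \<Phi> (u n) f \<in> S"
      unfolding eventually_sequentially by blast
  qed
  then have "\<exists>n. gleason_dist (\<Phi> w) (\<Phi> (u n)) < 1"
    using continuous_map_max_idealD(1)[OF \<Phi>] w uW by (intro gleason_close_to_limit) auto
  then show False
    using u by blast
qed

lemma connected_first_countable_in_gleason_part: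
  assumes conn: "connected_space W" and W: "first_countable W"
    and \<Phi>: "continuous_map W max_ideal_topology \<Phi>"
    and p: "p \<in> topspace W" and q: "q \<in> topspace W"
  shows "gleason_dist (\<Phi> p) (\<Phi> q) < 1"
proof -
  note M = continuous_map_max_idealD(1)[OF \<Phi>]
  obtain U where U: "\<And>w. w \<in> topspace W \<Longrightarrow> openin W (U w) \<and> w \<in> U w"
    and close: "\<And>w u. w \<in> topspace W \<Longrightarrow> u \<in> U w \<Longrightarrow> gleason_dist (\<Phi> w) (\<Phi> u) < 1"
    using locally_in_gleason_part[OF W \<Phi>] by metis
  have UW: "u \<in> topspace W" if "w \<in> topspace W" "u \<in> U w" for w u
    using U[OF that(1)] that(2) openin_subset by blast
  define A where "A = {w \<in> topspace W. gleason_dist (\<Phi> p) (\<Phi> w) < 1}"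
  have "openin W A"
    unfolding openin_subopen[of W A]
  proof
    fix w assume w: "w \<in> A"
    then have "U w \<subseteq> A"
      using gleason_less_1_trans[OF M M M, of p w] p UW close by (auto simp: A_def)
    then show "\<exists>T. openin W T \<and> w \<in> T \<and> T \<subseteq> A"
      using U w by (auto simp: A_def)
  qed
  moreover have "openin W (topspace W - A)"
    unfolding openin_subopen[of W "topspace W - A"]
  proof
    fix w assume w: "w \<in> topspace W - A"
    have "u \<notin> A" if u: "u \<in> U w" for u
    proof
      assume "u \<in> A"
      moreover have "gleason_dist (\<Phi> u) (\<Phi> w) < 1"
        by (rule gleason_less_1_sym[OF M M close[OF _ u]]) (use w UW[OF _ u] in auto)
      ultimately have "gleason_dist (\<Phi> p) (\<Phi> w) < 1"
        using gleason_less_1_trans[OF M M M, of p u w] p w by (auto simp: A_def)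
      then show False
        using w by (simp add: A_def)
    qed
    then show "\<exists>T. openin W T \<and> w \<in> T \<and> T \<subseteq> topspace W - A"
      using U[of w] UW[of w] w by (intro exI[of _ "U w"]) auto
  qed
  moreover have "A \<subseteq> topspace W"
    by (auto simp: A_def)
  ultimately have "A = {} \<or> A = topspace W"
    using conn unfolding connected_space_clopen_in closedin_def by blast
  moreover have "p \<in> A"
    using close U p gleason_less_1_trans[OF M M M, of p p p] by (auto simp: A_def)
  ultimately show ?thesis
    using q by (auto simp: A_def)
qed

theorem theorem1p5:
  fixes Z :: "'z topology"
    and z :: 'z
    and x :: "hinf \<Rightarrow> complex"
    and F :: "'z \<Rightarrow> (hinf \<Rightarrow> complex)"
  assumes "class_C TYPE('w) Z"
    and "z \<in> topspace Z"
    and "x \<in> max_ideal_space"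
    and "continuous_map Z max_ideal_topology F"
    and "F z = x"
  shows "F ` topspace Z \<subseteq> gleason_part x"
proof
  fix y assume "y \<in> F ` topspace Z"
  then obtain v where v: "v \<in> topspace Z" "y = F v"
    by blast
  obtain W :: "'w topology" and h where W: "connected_space W" "first_countable W"
    and h: "continuous_map W Z h" and zv: "z \<in> h ` topspace W" "v \<in> h ` topspace W"
    using assms(1,2) v unfolding class_C_def by metis
  then obtain p q where "p \<in> topspace W" "q \<in> topspace W" "h p = z" "h q = v"
    by auto
  then have "gleason_dist x y < 1"
    using connected_first_countable_in_gleason_part[OF W continuous_map_compose[OF h assms(4)]]
      assms(5) v by fastforce
  then show "y \<in> gleason_part x"
    using continuous_map_max_idealD(1)[OF assms(4) v(1)] v by (simp add: gleason_part_def)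
qed

end
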